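(* Convergence of an uncertain linear system does not imply convergence of the dual system, in both discrete and continuous time. That is, for each of the two notions of convergence (weak and strong): (DT) there exist matrices $A_1,\dots,A_M$ such that the difference inclusion $x(k+1)=A(w(k))x(k)$ is convergent but the dual difference inclusion $x(k+1)=A^\top(w(k))x(k)$ is not convergent (in the same sense); (CT) there exist matrices $A_1,\dots,A_M$ such that the differential inclusion $\dot x(t)=A(w(t))x(t)$ is convergent but the dual differential inclusion $\dot x(t)=A^\top(w(t))x(t)$ is not convergent (in the same sense).
   Context: For $A_1,\dots,A_M\in\mathbb{R}^{n\times n}$ and $\mathcal{M}=\{1,\dots,M\}$, $A(w)=\sum_{i\in\mathcal{M}}w_iA_i$ with $w\in\mathcal{W}=\{w\in\mathbb{R}^M:\ \sum_{i\in\mathcal{M}}w_i=1,\ w_i\ge0\ \forall i\in\mathcal{M}\}$; the dual system is the one generated by $A_1^\top,\dots,A_M^\top$, with $A^\top(w)=\sum_{i\in\mathcal{M}}w_iA_i^\top$. The inclusion generated by $\{A_i\}_{i\in\mathcal{M}}$ is weakly convergent if for every sequence $w(k)\in\mathcal{W}$, $k\in\mathbb{N}$ (resp. every measurable function $w(t)\in\mathcal{W}$, $t\ge0$) and every $x(0)\in\mathbb{R}^n$ there exists $\bar x\in\mathbb{R}^n$ such that the solution converges to $\bar x$ as time tends to infinity. It is strongly convergent if for every such $w$ and $x(0)$ the solution converges to some $\bar x\in\bar{\mathcal{X}}$, where $\bar{\mathcal{X}}=\bigcap_{i\in\mathcal{M}}\ker(A_i-I)$ in discrete time and $\bar{\mathcal{X}}=\bigcap_{i\in\mathcal{M}}\ker(A_i)$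 in continuous time. *)

theory Defs
  imports "HOL-Analysis.Analysis" "Jordan_Normal_Form.Matrix_Kernel"
begin

text \<open>
  The dimension \<open>n\<close> is existentially quantified in the theorem, so matrices and vectors are the
  carrier-based ones of \<open>Jordan_Normal_Form\<close>, not the type-indexed ones of \<open>HOL-Analysis\<close>.
  Below, \<open>$\<close> is the indexing of the former.
\<close>

unbundle no vec_syntax
notation vec_index (infixl \<open>$\<close> 100)

text \<open>
  A weight vector is a function on \<open>nat\<close> of which only the values at \<open>1, \<dots>, M\<close> matter;
  the same holds for a family \<open>A\<close> of \<open>M\<close> matrices.
\<close>

definition weights :: "nat \<Rightarrow> (nat \<Rightarrow> real) set" where
  "weights M = {w. (\<Sum>i\<in>{1..M}. w i) = 1 \<and> (\<forall>i\<in>{1..M}. w i \<ge> 0)}"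

definition comb_mat :: "nat \<Rightarrow> nat \<Rightarrow> (nat \<Rightarrow> real mat) \<Rightarrow> (nat \<Rightarrow> real) \<Rightarrow> real mat" where
  "comb_mat n M A w = mat n n (\<lambda>(r, c). \<Sum>i\<in>{1..M}. w i * A i $$ (r, c))"

text \<open>
  The type \<open>real vec\<close> carries no topology; convergence in \<open>\<real>\<^sup>n\<close> is convergence of all coordinates.
\<close>

definition vec_tendsto :: "nat \<Rightarrow> ('t \<Rightarrow> real vec) \<Rightarrow> real vec \<Rightarrow> 't filter \<Rightarrow> bool" where
  "vec_tendsto n x xbar F \<longleftrightarrow> (\<forall>r<n. ((\<lambda>t. x t $ r) \<longlongrightarrow> xbar $ r) F)"

subsection \<open>Discrete time\<close>

definition dt_weights :: "nat \<Rightarrow> (nat \<Rightarrow> nat \<Rightarrow> real) \<Rightarrow> bool" where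
  "dt_weights M w \<longleftrightarrow> (\<forall>k. w k \<in> weights M)"

definition dt_solution ::
    "nat \<Rightarrow> nat \<Rightarrow> (nat \<Rightarrow> real mat) \<Rightarrow> (nat \<Rightarrow> nat \<Rightarrow> real) \<Rightarrow> real vec \<Rightarrow> (nat \<Rightarrow> real vec) \<Rightarrow> bool" where
  "dt_solution n M A w x0 x \<longleftrightarrow>
     x 0 = x0 \<and> (\<forall>k. x (Suc k) = comb_mat n M A (w k) *\<^sub>v x k)"

definition dt_equilibria :: "nat \<Rightarrow> nat \<Rightarrow> (nat \<Rightarrow> real mat) \<Rightarrow> real vec set" where
  "dt_equilibria n M A = carrier_vec n \<inter> (\<Inter>i\<in>{1..M}. mat_kernel (A i - 1\<^sub>m n))"

definition dt_weakly_convergent :: "nat \<Rightarrow> nat \<Rightarrow> (nat \<Rightarrow> real mat) \<Rightarrow> bool" where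
  "dt_weakly_convergent n M A \<longleftrightarrow>
     (\<forall>w. dt_weights M w \<longrightarrow> (\<forall>x0\<in>carrier_vec n. \<forall>x. dt_solution n M A w x0 x \<longrightarrow>
       (\<exists>xbar\<in>carrier_vec n. vec_tendsto n x xbar sequentially)))"

definition dt_strongly_convergent :: "nat \<Rightarrow> nat \<Rightarrow> (nat \<Rightarrow> real mat) \<Rightarrow> bool" where
  "dt_strongly_convergent n M A \<longleftrightarrow>
     (\<forall>w. dt_weights M w \<longrightarrow> (\<forall>x0\<in>carrier_vec n. \<forall>x. dt_solution n M A w x0 x \<longrightarrow>
       (\<exists>xbar\<in>dt_equilibria n M A. vec_tendsto n x xbar sequentially)))"

subsection \<open>Continuous time\<close>

definition ct_weights :: "nat \<Rightarrow> (real \<Rightarrow> nat \<Rightarrow> real) \<Rightarrow> bool" where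
  "ct_weights M w \<longleftrightarrow>
     (\<forall>i\<in>{1..M}. (\<lambda>t. w t i) \<in> borel_measurable (lebesgue_on {0..})) \<and>
     (\<forall>t\<ge>0. w t \<in> weights M)"

text \<open>
  As \<open>w\<close> is only measurable, solutions are meant in the sense of Caratheodory: \<open>x\<close> is locally
  absolutely continuous and satisfies the differential equation almost everywhere on
  \<open>[0, \<infinity>)\<close>, that is, \<open>x t = x0 + \<integral>\<^sub>0\<^sup>t A (w s) x s ds\<close> with a Lebesgue
  integrable integrand, for all \<open>t \<ge> 0\<close>. For weights as above and each \<open>x0\<close> there is exactly
  one such \<open>x\<close> on \<open>[0, \<infinity>)\<close>, so quantifying over all solutions below is quantifying
  over the solution.
\<close>

definition ct_solution ::
    "nat \<Rightarrow> nat \<Rightarrow> (nat \<Rightarrow> real mat) \<Rightarrow> (real \<Rightarrow> nat \<Rightarrow> real) \<Rightarrow> real vec \<Rightarrow> (real \<Rightarrow> real vec) \<Rightarrow> bool" where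
  "ct_solution n M A w x0 x \<longleftrightarrow>
     x 0 = x0 \<and>
     (\<forall>t\<ge>0. x t \<in> carrier_vec n) \<and>
     (\<forall>t\<ge>0. \<forall>r<n.
        set_integrable lebesgue {0..t} (\<lambda>s. (comb_mat n M A (w s) *\<^sub>v x s) $ r) \<and>
        x t $ r = x0 $ r +
          set_lebesgue_integral lebesgue {0..t} (\<lambda>s. (comb_mat n M A (w s) *\<^sub>v x s) $ r))"

definition ct_equilibria :: "nat \<Rightarrow> nat \<Rightarrow> (nat \<Rightarrow> real mat) \<Rightarrow> real vec set" where
  "ct_equilibria n M A = carrier_vec n \<inter> (\<Inter>i\<in>{1..M}. mat_kernel (A i))"

definition ct_weakly_convergent :: "nat \<Rightarrow> nat \<Rightarrow> (nat \<Rightarrow> real mat) \<Rightarrow> bool" where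
  "ct_weakly_convergent n M A \<longleftrightarrow>
     (\<forall>w. ct_weights M w \<longrightarrow> (\<forall>x0\<in>carrier_vec n. \<forall>x. ct_solution n M A w x0 x \<longrightarrow>
       (\<exists>xbar\<in>carrier_vec n. vec_tendsto n x xbar at_top)))"

definition ct_strongly_convergent :: "nat \<Rightarrow> nat \<Rightarrow> (nat \<Rightarrow> real mat) \<Rightarrow> bool" where
  "ct_strongly_convergent n M A \<longleftrightarrow>
     (\<forall>w. ct_weights M w \<longrightarrow> (\<forall>x0\<in>carrier_vec n. \<forall>x. ct_solution n M A w x0 x \<longrightarrow>
       (\<exists>xbar\<in>ct_equilibria n M A. vec_tendsto n x xbar at_top)))"

end

theory Submission
  imports Defs "HOL-Real_Asymp.Real_Asymp"
begin

text \<open>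
  One family of planar matrices settles all four cases. Let the uncertainty act only on the
  coupling from a decaying coordinate into a conserved one:
  \<open>A(w) = [[a, 0], [w\<^sub>1, b]]\<close> with \<open>(a, b) = (0, 1)\<close> in discrete time and
  \<open>(a, b) = (-1, 0)\<close> in continuous time.

  The first coordinate then vanishes exponentially whatever the weights are, so the uncertain input
  to the second coordinate is absolutely summable and the second coordinate converges; every vector
  with first coordinate zero is a common equilibrium, so the convergence is even strong
  (\<open>dt_cascade_strongly_convergent\<close>, \<open>ct_cascade_strongly_convergent\<close>).

  Transposition reverses the direction of the coupling. Now the conserved coordinate, held at
  \<open>1\<close>, feeds the uncertain weight \<open>w\<^sub>1\<close> into the stable coordinate, which tracks it and
  keeps oscillating when \<open>w\<^sub>1\<close> does, so not even weak convergence holds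
  (\<open>dt_cascade_dual_not_weakly_convergent\<close>, \<open>ct_cascade_dual_not_weakly_convergent\<close>).
  As strong convergence implies weak convergence, both notions are refuted by the same matrices.
\<close>


section \<open>The cascade and its dual\<close>

text \<open>
  Two matrices suffice: only the first one has the coupling, so a convex combination of the two
  has coupling strength exactly \<open>w\<^sub>1\<close>, which ranges over all of \<open>[0, 1]\<close>.
\<close>

definition cascade :: "real \<Rightarrow> real \<Rightarrow> nat \<Rightarrow> real mat" where
  "cascade a b i = mat 2 2 (\<lambda>(r, c). [[a, 0], [of_bool (i = 1), b]] ! r ! c)"

lemma cascade_carrier: "cascade a b i \<in> carrier_mat 2 2"
  by (simp add: cascade_def)

lemma cascade_index:
  "cascade a b i $$ (0, 0) = a" "cascade a b i $$ (0, 1) = 0"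
  "cascade a b i $$ (1, 0) = of_bool (i = 1)" "cascade a b i $$ (1, 1) = b"
  by (simp_all add: cascade_def)

lemma mult_mat_vec_2:
  assumes "A \<in> carrier_mat 2 2" "v \<in> carrier_vec 2"
  shows "(A *\<^sub>v v) $ 0 = A $$ (0, 0) * v $ 0 + A $$ (0, 1) * v $ 1"
    and "(A *\<^sub>v v) $ 1 = A $$ (1, 0) * v $ 0 + A $$ (1, 1) * v $ 1"
  using assms by (auto simp: scalar_prod_def numeral_2_eq_2)

lemma comb_mat_carrier: "comb_mat n M A w \<in> carrier_mat n n"
  by (simp add: comb_mat_def)

lemma weights_2_iff: "w \<in> weights 2 \<longleftrightarrow> w 1 + w 2 = 1 \<and> 0 \<le> w 1 \<and> 0 \<le> w 2"
proof -
  have "{1..2::nat} = {1, 2}" by auto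
  then show ?thesis by (auto simp: weights_def)
qed

lemma comb_mat_cascade:
  assumes "w \<in> weights 2"
  shows "comb_mat 2 2 (cascade a b) w = mat 2 2 (\<lambda>(r, c). [[a, 0], [w 1, b]] ! r ! c)"
    and "comb_mat 2 2 (\<lambda>i. transpose_mat (cascade a b i)) w =
      mat 2 2 (\<lambda>(r, c). [[a, w 1], [0, b]] ! r ! c)"
proof -
  have i: "{1..2::nat} = {1, 2}" by auto
  have w2: "w 2 = 1 - w 1" using assms by (simp add: weights_2_iff)
  show "comb_mat 2 2 (cascade a b) w = mat 2 2 (\<lambda>(r, c). [[a, 0], [w 1, b]] ! r ! c)"
    and "comb_mat 2 2 (\<lambda>i. transpose_mat (cascade a b i)) w =
      mat 2 2 (\<lambda>(r, c). [[a, w 1], [0, b]] ! r ! c)"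
    unfolding comb_mat_def i
    by (intro cong_mat; force simp: cascade_def less_2_cases_iff w2 left_diff_distrib)+
qed

lemma cascade_comb_mult:
  assumes "w \<in> weights 2" "v \<in> carrier_vec 2"
  shows "(comb_mat 2 2 (cascade a b) w *\<^sub>v v) $ 0 = a * v $ 0"
    and "(comb_mat 2 2 (cascade a b) w *\<^sub>v v) $ 1 = w 1 * v $ 0 + b * v $ 1"
  unfolding comb_mat_cascade[OF assms(1)] using assms(2)
  by (simp_all add: scalar_prod_def numeral_2_eq_2)

lemma cascade_dual_comb_mult:
  assumes "w \<in> weights 2" "v \<in> carrier_vec 2"
  shows "(comb_mat 2 2 (\<lambda>i. transpose_mat (cascade a b i)) w *\<^sub>v v) $ 0 = a * v $ 0 + w 1 * v $ 1"
    and "(comb_mat 2 2 (\<lambda>i. transpose_mat (cascade a b i)) w *\<^sub>v v) $ 1 = b * v $ 1"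
  unfolding comb_mat_cascade[OF assms(1)] using assms(2)
  by (simp_all add: scalar_prod_def numeral_2_eq_2)

lemma vec_2_eqI:
  assumes "v \<in> carrier_vec 2" "u \<in> carrier_vec 2" "v $ 0 = u $ 0" "v $ 1 = u $ 1"
  shows "v = u"
  using assms by (intro eq_vecI) (auto simp: less_2_cases_iff)

lemma vec_tendsto_2_iff:
  "vec_tendsto 2 x v F \<longleftrightarrow> ((\<lambda>t. x t $ 0) \<longlongrightarrow> v $ 0) F \<and> ((\<lambda>t. x t $ 1) \<longlongrightarrow> v $ 1) F"
  by (auto simp: vec_tendsto_def less_2_cases_iff)

lemma dt_strongly_imp_weakly_convergent:
  "dt_strongly_convergent n M A \<Longrightarrow> dt_weakly_convergent n M A"
  unfolding dt_strongly_convergent_def dt_weakly_convergent_def dt_equilibria_def by blast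

lemma ct_strongly_imp_weakly_convergent:
  "ct_strongly_convergent n M A \<Longrightarrow> ct_weakly_convergent n M A"
  unfolding ct_strongly_convergent_def ct_weakly_convergent_def ct_equilibria_def by blast


section \<open>Discrete time\<close>

lemma dt_equilibria_cascade:
  assumes "v \<in> carrier_vec 2" "v $ 0 = 0"
  shows "v \<in> dt_equilibria 2 M (cascade 0 1)"
proof -
  have "v \<in> mat_kernel (cascade 0 1 i - 1\<^sub>m 2)" for i
  proof (rule mat_kernelI)
    have C: "cascade 0 1 i - 1\<^sub>m 2 \<in> carrier_mat 2 2"
      by (intro minus_carrier_mat one_carrier_mat)
    show "cascade 0 1 i - 1\<^sub>m 2 \<in> carrier_mat 2 2" by (rule C)
    show "(cascade 0 1 i - 1\<^sub>m 2) *\<^sub>v v = 0\<^sub>v 2"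
      by (rule vec_2_eqI)
        (use C mult_mat_vec_2[OF C assms(1)] assms cascade_index[of 0 1 i] in auto)
  qed (rule assms)
  then show ?thesis using assms by (simp add: dt_equilibria_def)
qed

text \<open>One step empties the first coordinate, and from then on the state is at an equilibrium.\<close>

lemma dt_cascade_strongly_convergent: "dt_strongly_convergent 2 2 (cascade 0 1)"
  unfolding dt_strongly_convergent_def
proof (intro allI ballI impI)
  fix w x0 x
  assume "dt_weights 2 w" and x0: "x0 \<in> carrier_vec 2"
    and "dt_solution 2 2 (cascade 0 1) w x0 x"
  then have w: "w k \<in> weights 2" and init: "x 0 = x0"
    and step: "x (Suc k) = comb_mat 2 2 (cascade 0 1) (w k) *\<^sub>v x k" for k
    by (auto simp: dt_weights_def dt_solution_def)
  have x: "x k \<in> carrier_vec 2" for k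
    by (induction k) (use init x0 step mult_mat_vec_carrier[OF comb_mat_carrier] in auto)
  have 0: "x (Suc k) $ 0 = 0" for k
    using cascade_comb_mult(1)[OF w x, of 0 1] step by simp
  have 1: "x (Suc (Suc k)) $ 1 = x (Suc k) $ 1" for k
    using cascade_comb_mult(2)[OF w x, of 0 1 "Suc k" "Suc k"] by (simp add: step[of "Suc k"] 0)
  define v where "v = x (Suc 0)"
  have eq: "x (Suc k) = v" for k
    by (induction k) (use 0 1 x in \<open>auto intro!: vec_2_eqI simp: v_def\<close>)
  have "vec_tendsto 2 x v sequentially"
    unfolding vec_tendsto_def
  proof (intro allI impI)
    fix r
    show "(\<lambda>k. x k $ r) \<longlonglongrightarrow> v $ r"
      by (rule LIMSEQ_imp_Suc) (simp add: eq)
  qed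
  moreover have "v \<in> dt_equilibria 2 2 (cascade 0 1)"
    unfolding v_def by (rule dt_equilibria_cascade[OF x 0])
  ultimately show "\<exists>v\<in>dt_equilibria 2 2 (cascade 0 1). vec_tendsto 2 x v sequentially"
    by blast
qed

text \<open>The stable coordinate copies the last weight, which may alternate between its extremes.\<close>

lemma dt_cascade_dual_not_weakly_convergent:
  "\<not> dt_weakly_convergent 2 2 (\<lambda>i. transpose_mat (cascade 0 1 i))"
proof
  assume conv: "dt_weakly_convergent 2 2 (\<lambda>i. transpose_mat (cascade 0 1 i))"
  define w :: "nat \<Rightarrow> nat \<Rightarrow> real" where "w k i = of_bool (even k \<longleftrightarrow> i = 1)" for k i
  define y :: "nat \<Rightarrow> real vec" where "y k = vec_of_list [of_bool (odd k), 1]" for k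
  have w: "w k \<in> weights 2" for k by (simp add: weights_2_iff w_def)
  have y: "y k \<in> carrier_vec 2" "y k $ 0 = of_bool (odd k)" "y k $ 1 = 1" for k
    by (simp_all add: y_def carrier_vecI)
  have "y (Suc k) = comb_mat 2 2 (\<lambda>i. transpose_mat (cascade 0 1 i)) (w k) *\<^sub>v y k" for k
    by (rule vec_2_eqI)
      (use y w mult_mat_vec_carrier[OF comb_mat_carrier] cascade_dual_comb_mult[OF w y(1)]
        in \<open>auto simp: w_def\<close>)
  then have "dt_solution 2 2 (\<lambda>i. transpose_mat (cascade 0 1 i)) w (y 0) y"
    by (simp add: dt_solution_def)
  moreover have "dt_weights 2 w" using w by (simp add: dt_weights_def)
  ultimately obtain v where "vec_tendsto 2 y v sequentially"
    using conv y(1) unfolding dt_weakly_convergent_def by blast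
  then have lim: "(\<lambda>k. of_bool (odd k) :: real) \<longlonglongrightarrow> v $ 0"
    by (simp add: vec_tendsto_2_iff y)
  have "(\<lambda>k. of_bool (odd (2 * k)) :: real) \<longlonglongrightarrow> v $ 0"
    by (rule filterlim_compose[OF lim]) (rule filterlim_subseq, simp add: strict_mono_def)
  moreover have "(\<lambda>k. of_bool (odd (2 * k + 1)) :: real) \<longlonglongrightarrow> v $ 0"
    by (rule filterlim_compose[OF lim]) (rule filterlim_subseq, simp add: strict_mono_def)
  ultimately show False
    by (simp add: LIMSEQ_const_iff)
qed


section \<open>Continuous time\<close>

text \<open>
  A Caratheodory solution of \<open>f' = a f\<close> is the classical one: being an indefinite integral it
  is continuous, hence so is the integrand, hence it is differentiable.
\<close>

lemma caratheodory_scalar_linear: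
  fixes f :: "real \<Rightarrow> real"
  assumes int: "\<And>t. 0 \<le> t \<Longrightarrow> set_integrable lebesgue {0..t} (\<lambda>s. a * f s)"
    and eq: "\<And>t. 0 \<le> t \<Longrightarrow> f t = c + set_lebesgue_integral lebesgue {0..t} (\<lambda>s. a * f s)"
    and "0 \<le> t"
  shows "f t = c * exp (a * t)"
proof -
  have eq': "f s = c + integral {0..s} (\<lambda>s. a * f s)" if "0 \<le> s" for s
    using eq[OF that] set_lebesgue_integral_eq_integral(2)[OF int[OF that]] by simp
  have "continuous_on {0..t} (\<lambda>s. c + integral {0..s} (\<lambda>s. a * f s))"
    by (intro continuous_intros indefinite_integral_continuous_1
        set_lebesgue_integral_eq_integral(1) int \<open>0 \<le> t\<close>)
  then have cont: "continuous_on {0..t} f"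
    by (rule continuous_on_eq) (rule eq'[symmetric], simp)
  have deriv: "(f has_real_derivative a * f s) (at s within {0..t})" if "s \<in> {0..t}" for s
  proof (rule has_field_derivative_transform_within[where d = 1])
    show "((\<lambda>s. c + integral {0..s} (\<lambda>s. a * f s)) has_real_derivative a * f s)
        (at s within {0..t})"
      by (rule DERIV_cong[OF DERIV_add[OF DERIV_const integral_has_real_derivative]])
        (use that in \<open>auto intro!: continuous_intros cont\<close>)
  qed (use that eq'[symmetric] in \<open>simp_all del: integral_mult_right\<close>)
  have "((\<lambda>s. f s * exp (- a * s)) has_real_derivative 0) (at s within {0..t})" if "s \<in> {0..t}" for s
    by (rule derivative_eq_intros deriv[OF that] refl)+ (simp add: algebra_simps)
  then obtain d where "\<And>s. s \<in> {0..t} \<Longrightarrow> f s * exp (- a * s) = d"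
    using has_field_derivative_zero_constant[of "{0..t}" "\<lambda>s. f s * exp (- a * s)"] by auto
  from this[of 0] this[of t] have "f t * exp (- a * t) = f 0" using \<open>0 \<le> t\<close> by simp
  moreover have "f 0 = c" using eq'[of 0] by simp
  ultimately show ?thesis by (simp add: exp_minus field_simps)
qed

lemma ct_equilibria_cascade:
  assumes "v \<in> carrier_vec 2" "v $ 0 = 0"
  shows "v \<in> ct_equilibria 2 M (cascade a 0)"
proof -
  have "v \<in> mat_kernel (cascade a 0 i)" for i
  proof (rule mat_kernelI)
    show "cascade a 0 i *\<^sub>v v = 0\<^sub>v 2"
      by (rule vec_2_eqI)
        (use mult_mat_vec_2[OF cascade_carrier assms(1)] assms cascade_index[of a 0 i]
          mult_mat_vec_carrier[OF cascade_carrier] in auto)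
  qed (rule cascade_carrier assms)+
  then show ?thesis using assms by (simp add: ct_equilibria_def)
qed

text \<open>
  The second coordinate is the integral of \<open>w\<^sub>1\<close> times an exponential, which is dominated by an
  integrable function on the whole half-line because \<open>0 \<le> w\<^sub>1 \<le> 1\<close>.
\<close>

lemma ct_cascade_strongly_convergent: "ct_strongly_convergent 2 2 (cascade (- 1) 0)"
  unfolding ct_strongly_convergent_def
proof (intro allI ballI impI)
  fix w x0 x
  assume "ct_weights 2 w" and x0: "x0 \<in> carrier_vec 2"
    and sol: "ct_solution 2 2 (cascade (- 1) 0) w x0 x"
  then have w: "\<And>t. 0 \<le> t \<Longrightarrow> w t \<in> weights 2"
    and meas: "(\<lambda>t. w t 1) \<in> borel_measurable (lebesgue_on {0..})"
    and x: "\<And>t. 0 \<le> t \<Longrightarrow> x t \<in> carrier_vec 2"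
    by (auto simp: ct_weights_def ct_solution_def)
  let ?F = "\<lambda>r s. (comb_mat 2 2 (cascade (- 1) 0) (w s) *\<^sub>v x s) $ r"
  have int: "set_integrable lebesgue {0..t} (?F r)"
    and eq: "x t $ r = x0 $ r + (LINT s:{0..t}|lebesgue. ?F r s)" if "0 \<le> t" "r < 2" for t r
    using sol that by (auto simp: ct_solution_def)
  have F0: "?F 0 s = - 1 * x s $ 0" and F1: "?F 1 s = w s 1 * x s $ 0" if "0 \<le> s" for s
    using cascade_comb_mult[OF w[OF that] x[OF that], of "- 1" 0] by simp_all

  have x0_eq: "x t $ 0 = x0 $ 0 * exp (- 1 * t)" if "0 \<le> t" for t
  proof (rule caratheodory_scalar_linear[OF _ _ that])
    fix t :: real assume t: "0 \<le> t"
    show "set_integrable lebesgue {0..t} (\<lambda>s. - 1 * x s $ 0)"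
      using int[OF t, of 0] F0 by (subst set_integrable_cong[OF refl refl, of _ _ "?F 0"]) auto
    show "x t $ 0 = x0 $ 0 + (LINT s:{0..t}|lebesgue. - 1 * x s $ 0)"
      using eq[OF t, of 0] F0 by (subst set_lebesgue_integral_cong[of _ _ _ "?F 0"]) auto
  qed
  define g where "g s = w s 1 * (x0 $ 0 * exp (- 1 * s))" for s
  have x1_eq: "x t $ 1 = x0 $ 1 + (LINT s:{0..t}|lebesgue. g s)" if "0 \<le> t" for t
    using eq[OF that, of 1] F1 x0_eq
    by (subst set_lebesgue_integral_cong[of _ _ _ "?F 1"]) (auto simp: g_def)
  have "set_integrable lebesgue {0..} g"
  proof (rule measurable_bounded_by_integrable_imp_absolutely_integrable)
    have "(\<lambda>s. x0 $ 0 * exp (- 1 * s)) \<in> borel_measurable (lebesgue_on {0..})"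
      by (intro continuous_imp_measurable_on_sets_lebesgue continuous_intros) auto
    then show "g \<in> borel_measurable (lebesgue_on {0..})"
      unfolding g_def using meas by (rule borel_measurable_times[rotated])
    show "(\<lambda>s. \<bar>x0 $ 0\<bar> * exp (- 1 * s)) integrable_on {0..}"
      using integrable_on_exp_minus_to_infinity[of 1 0] by (intro integrable_on_mult_right) simp
    fix s :: real assume "s \<in> {0..}"
    then have "\<bar>w s 1\<bar> \<le> 1" using w[of s] by (auto simp: weights_2_iff)
    then show "norm (g s) \<le> \<bar>x0 $ 0\<bar> * exp (- 1 * s)"
      by (simp add: g_def abs_mult mult_left_le_one_le)
  qed auto
  then have "((\<lambda>t. LINT s:{0..t}|lebesgue. g s) \<longlongrightarrow> (LINT s:{0..}|lebesgue. g s)) at_top"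
    by (intro tendsto_set_lebesgue_integral_at_top) auto
  then have lim: "((\<lambda>t. x0 $ 1 + (LINT s:{0..t}|lebesgue. g s)) \<longlongrightarrow>
      x0 $ 1 + (LINT s:{0..}|lebesgue. g s)) at_top"
    by (intro tendsto_intros)
  define v where "v = vec_of_list [0, x0 $ 1 + (LINT s:{0..}|lebesgue. g s)]"
  have v: "v \<in> carrier_vec 2" "v $ 0 = 0" "v $ 1 = x0 $ 1 + (LINT s:{0..}|lebesgue. g s)"
    by (simp_all add: v_def carrier_vecI)
  have ge0: "eventually (\<lambda>t::real. 0 \<le> t) at_top" by (rule eventually_ge_at_top)
  have "((\<lambda>t. x t $ 1) \<longlongrightarrow> v $ 1) at_top"
    unfolding v by (rule Lim_transform_eventually[OF lim])
      (use ge0 in eventually_elim, simp add: x1_eq[unfolded One_nat_def])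
  moreover have "((\<lambda>t::real. x0 $ 0 * exp (- 1 * t)) \<longlongrightarrow> 0) at_top"
    by real_asymp
  then have "((\<lambda>t. x t $ 0) \<longlongrightarrow> v $ 0) at_top"
    unfolding v by (rule Lim_transform_eventually) (use ge0 in eventually_elim, simp add: x0_eq)
  ultimately have "vec_tendsto 2 x v at_top" by (simp add: vec_tendsto_2_iff)
  then show "\<exists>v\<in>ct_equilibria 2 2 (cascade (- 1) 0). vec_tendsto 2 x v at_top"
    using ct_equilibria_cascade[OF v(1,2)] by blast
qed

text \<open>
  The trajectory is prescribed and the weight is read off from it: the stable coordinate is to be
  \<open>p t = 1/2 + sin t / 4\<close>, so \<open>w\<^sub>1 = p' + p\<close>, and the amplitude is small enough for this to
  stay in \<open>[0, 1]\<close>.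
\<close>

lemma ct_cascade_dual_not_weakly_convergent:
  "\<not> ct_weakly_convergent 2 2 (\<lambda>i. transpose_mat (cascade (- 1) 0 i))"
proof
  let ?A = "\<lambda>i. transpose_mat (cascade (- 1) 0 i)"
  assume conv: "ct_weakly_convergent 2 2 ?A"
  \<comment> \<open>The limit would have to be both \<open>p (2 k \<pi>) = 1/2\<close> and \<open>p (\<pi>/2 + 2 k \<pi>) = 3/4\<close>.\<close>
  define p :: "real \<Rightarrow> real" where "p t = 1/2 + sin t / 4" for t
  define w :: "real \<Rightarrow> nat \<Rightarrow> real"
    where "w t i = (if i = 1 then p t + cos t / 4 else 1 - (p t + cos t / 4))" for t i
  define y where "y t = vec_of_list [p t, 1]" for t
  have "0 \<le> p t + cos t / 4" "p t + cos t / 4 \<le> 1" for t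
    using sin_le_one[of t] sin_ge_minus_one[of t] cos_le_one[of t] cos_ge_minus_one[of t]
    unfolding p_def by linarith+
  then have w: "w t \<in> weights 2" for t
    by (simp add: weights_2_iff w_def)
  have y: "y t \<in> carrier_vec 2" "y t $ 0 = p t" "y t $ 1 = 1" for t
    by (simp_all add: y_def carrier_vecI)
  have "(\<lambda>t. w t i) \<in> borel_measurable (lebesgue_on {0..})" for i
    unfolding w_def p_def
    by (cases "i = 1"; simp; intro continuous_imp_measurable_on_sets_lebesgue continuous_intros)
      auto
  then have "ct_weights 2 w" using w by (simp add: ct_weights_def)
  moreover have "ct_solution 2 2 ?A w (y 0) y"
  proof -
    have F: "(comb_mat 2 2 ?A (w s) *\<^sub>v y s) $ 0 = cos s / 4"
      "(comb_mat 2 2 ?A (w s) *\<^sub>v y s) $ 1 = 0" for s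
      using cascade_dual_comb_mult[OF w y(1), of "- 1" 0] y(2,3) by (simp_all add: w_def)
    have int: "set_integrable lebesgue {0..t} (\<lambda>s. cos s / 4)" for t :: real
      by (intro absolutely_integrable_continuous_real continuous_intros) simp
    have "((\<lambda>s. cos s / 4) has_integral (sin t / 4 - sin 0 / 4)) {0..t}" if "0 \<le> t" for t :: real
      by (rule fundamental_theorem_of_calculus[OF that])
        (auto intro!: derivative_eq_intros
          simp: has_real_derivative_iff_has_vector_derivative[symmetric])
    then have "(LINT s:{0..t}|lebesgue. cos s / 4) = sin t / 4" if "0 \<le> t" for t :: real
      using set_lebesgue_integral_eq_integral(2)[OF int, of t] that
      by (auto dest!: integral_unique)
    then show ?thesis
      using int
      by (auto simp: ct_solution_def less_2_cases_iff F F[unfolded One_nat_def] y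
          y[unfolded One_nat_def] p_def set_integrable_def set_lebesgue_integral_def)
  qed
  ultimately obtain v where "vec_tendsto 2 y v at_top"
    using conv y(1) unfolding ct_weakly_convergent_def by blast
  then have lim: "(p \<longlongrightarrow> v $ 0) at_top"
    by (simp add: vec_tendsto_2_iff y)
  have "(\<lambda>k. p (2 * real k * pi)) \<longlonglongrightarrow> v $ 0"
    by (rule filterlim_compose[OF lim]) real_asymp
  moreover have "(\<lambda>k. p (pi / 2 + 2 * real k * pi)) \<longlonglongrightarrow> v $ 0"
    by (rule filterlim_compose[OF lim]) real_asymp
  moreover have "p (2 * real k * pi) = 1/2" "p (pi / 2 + 2 * real k * pi) = 3/4" for k
    using sin_2npi[of k] cos_2npi[of k] by (simp_all add: p_def sin_add mult_ac)
  ultimately show False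
    by (simp add: LIMSEQ_const_iff)
qed

theorem proposition9:
  shows "(\<exists>n M. \<exists>A :: nat \<Rightarrow> real mat. (\<forall>i\<in>{1..M}. A i \<in> carrier_mat n n) \<and>
           dt_weakly_convergent n M A \<and>
           \<not> dt_weakly_convergent n M (\<lambda>i. transpose_mat (A i))) \<and>
         (\<exists>n M. \<exists>A :: nat \<Rightarrow> real mat. (\<forall>i\<in>{1..M}. A i \<in> carrier_mat n n) \<and>
           dt_strongly_convergent n M A \<and>
           \<not> dt_strongly_convergent n M (\<lambda>i. transpose_mat (A i))) \<and>
         (\<exists>n M. \<exists>A :: nat \<Rightarrow> real mat. (\<forall>i\<in>{1..M}. A i \<in> carrier_mat n n) \<and>
           ct_weakly_convergent n M A \<and>
           \<not> ct_weakly_convergent n M (\<lambda>i. transpose_mat (A i))) \<and>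
         (\<exists>n M. \<exists>A :: nat \<Rightarrow> real mat. (\<forall>i\<in>{1..M}. A i \<in> carrier_mat n n) \<and>
           ct_strongly_convergent n M A \<and>
           \<not> ct_strongly_convergent n M (\<lambda>i. transpose_mat (A i)))"
proof (intro conjI)
  have carrier: "\<forall>i\<in>{1..2}. cascade a b i \<in> carrier_mat 2 2" for a b
    by (simp add: cascade_carrier)
  note dt = dt_cascade_strongly_convergent dt_cascade_dual_not_weakly_convergent
  note ct = ct_cascade_strongly_convergent ct_cascade_dual_not_weakly_convergent
  show "\<exists>n M. \<exists>A :: nat \<Rightarrow> real mat. (\<forall>i\<in>{1..M}. A i \<in> carrier_mat n n) \<and>
      dt_weakly_convergent n M A \<and> \<not> dt_weakly_convergent n M (\<lambda>i. transpose_mat (A i))"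
    using carrier dt dt_strongly_imp_weakly_convergent by blast
  show "\<exists>n M. \<exists>A :: nat \<Rightarrow> real mat. (\<forall>i\<in>{1..M}. A i \<in> carrier_mat n n) \<and>
      dt_strongly_convergent n M A \<and> \<not> dt_strongly_convergent n M (\<lambda>i. transpose_mat (A i))"
    using carrier dt dt_strongly_imp_weakly_convergent by blast
  show "\<exists>n M. \<exists>A :: nat \<Rightarrow> real mat. (\<forall>i\<in>{1..M}. A i \<in> carrier_mat n n) \<and>
      ct_weakly_convergent n M A \<and> \<not> ct_weakly_convergent n M (\<lambda>i. transpose_mat (A i))"
    using carrier ct ct_strongly_imp_weakly_convergent by blast
  show "\<exists>n M. \<exists>A :: nat \<Rightarrow> real mat. (\<forall>i\<in>{1..M}. A i \<in> carrier_mat n n) \<and>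
      ct_strongly_convergent n M A \<and> \<not> ct_strongly_convergent n M (\<lambda>i. transpose_mat (A i))"
    using carrier ct ct_strongly_imp_weakly_convergent by blast
qed

end
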